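(* (a) The Thue-Morse sequence contains exactly 161 distinct rich factors, the longest being of length $16$. (b) The Rudin-Shapiro sequence contains exactly 975 distinct rich factors, the longest being of length $30$. (c) The ordinary paperfolding sequence contains exactly 494 distinct rich factors, the longest being of length $23$. (d) The period-doubling sequence has a rich factor of every length. In fact, every factor of the period-doubling sequence is rich. (e) Every factor of the Fibonacci sequence is rich.
   Context: A palindrome is a word equal to its reversal. A word $x$ is rich if it has exactly $|x|+1$ distinct palindromic factors, including the empty word. Factors are finite contiguous blocks; the empty word is a factor (and is rich), and is included in the counts. Sequences: - Thue-Morse: the fixed point starting with $0$ of the morphism $0\to01$, $1\to10$. - Rudin-Shapiro ($00010010\cdots$): the image under the coding $n\mapsto\lfloor n/2\rfloor$ of the fixed point starting with $0$ of $0\to01$, $1\to02$, $2\to31$, $3\to32$. - Ordinary paperfolding ($00100110\cdots$): $p_{2n+1}=p_n$, $p_{4n}=0$, $p_{4n+2}=1$ for all $n\ge0$. - Period-doubling ($10111010\cdots$): the fixed point starting with $1$ of $1\to10$, $0\to11$. - Fibonacci ($01001010\cdots$): the fixed point starting with $0$ of $0\to01$, $1\to0$. *)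

theory Defs
  imports "HOL-Library.Sublist" "HOL-Library.Omega_Words_Fun"
begin

definition palindrome :: "'a list \<Rightarrow> bool"
  where "palindrome w \<longleftrightarrow> rev w = w"

definition rich :: "'a list \<Rightarrow> bool"
  where "rich w \<longleftrightarrow> card {p. sublist p w \<and> palindrome p} = length w + 1"

text \<open>The library term \<open>x [i \<rightarrow> j]\<close> is the block \<open>x i, \<dots>, x (j - 1)\<close>; it is empty if \<open>j \<le> i\<close>.\<close>

definition is_factor :: "'a list \<Rightarrow> 'a word \<Rightarrow> bool"
  where "is_factor w x \<longleftrightarrow> (\<exists>i j. w = x [i \<rightarrow> j])"

definition rich_factors :: "'a word \<Rightarrow> 'a list set"
  where "rich_factors x = {w. is_factor w x \<and> rich w}"


text \<open>A morphism is given by its values on letters.\<close>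

definition morph :: "('a \<Rightarrow> 'b list) \<Rightarrow> 'a list \<Rightarrow> 'b list"
  where "morph \<phi> w = concat (map \<phi> w)"

text \<open>
  The infinite word \<open>y\<close> is the image of the infinite word \<open>x\<close> if every finite prefix of \<open>y\<close>
  is a prefix of the image of some finite prefix of \<open>x\<close>.
\<close>

definition is_morphic_image :: "('a \<Rightarrow> 'b list) \<Rightarrow> 'a word \<Rightarrow> 'b word \<Rightarrow> bool"
  where "is_morphic_image \<phi> x y \<longleftrightarrow> (\<forall>k. \<exists>n. take k (morph \<phi> (x [0 \<rightarrow> n])) = y [0 \<rightarrow> k])"

definition morphic_fixed_point :: "('a \<Rightarrow> 'a list) \<Rightarrow> 'a \<Rightarrow> 'a word"
  where "morphic_fixed_point \<phi> a = (THE x. x 0 = a \<and> is_morphic_image \<phi> x x)"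

lemma morph_append: "morph \<phi> (u @ v) = morph \<phi> u @ morph \<phi> v"
  by (simp add: morph_def)

lemma length_morph_ge:
  assumes "\<forall>b. \<phi> b \<noteq> []"
  shows "length w \<le> length (morph \<phi> w)"
proof (induction w)
  case (Cons b w)
  have "1 \<le> length (\<phi> b)" using assms by (simp add: Suc_leI)
  then have "length w + 1 \<le> length (morph \<phi> w) + length (\<phi> b)" using Cons by (rule add_mono[rotated])
  then show ?case by (simp add: morph_def)
qed (simp add: morph_def)

lemma subsequence_split:
  assumes "m \<le> n"
  shows "x [0 \<rightarrow> n] = x [0 \<rightarrow> m] @ x [m \<rightarrow> n]"
  using subsequence_append[where i = m and j = "n - m" and w = x] assms by simp

lemma morph_prefix_of_fixed_point:
  assumes "is_morphic_image \<phi> x x"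
  shows "morph \<phi> (x [0 \<rightarrow> n]) = x [0 \<rightarrow> length (morph \<phi> (x [0 \<rightarrow> n]))]"
proof -
  let ?k = "length (morph \<phi> (x [0 \<rightarrow> n]))"
  obtain m where m: "take ?k (morph \<phi> (x [0 \<rightarrow> m])) = x [0 \<rightarrow> ?k]"
    using assms unfolding is_morphic_image_def by blast
  show ?thesis
  proof (cases "n \<le> m")
    case True
    then show ?thesis using m subsequence_split[OF True, of x] by (simp add: morph_append)
  next
    case False
    then have s: "morph \<phi> (x [0 \<rightarrow> n]) = morph \<phi> (x [0 \<rightarrow> m]) @ morph \<phi> (x [m \<rightarrow> n])"
      using subsequence_split[of m n x] by (simp add: morph_append)
    have "length (take ?k (morph \<phi> (x [0 \<rightarrow> m]))) = ?k"
      using m by simp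
    then have "?k \<le> length (morph \<phi> (x [0 \<rightarrow> m]))" by simp
    then have "morph \<phi> (x [m \<rightarrow> n]) = []" using s by simp
    then show ?thesis using m s by simp
  qed
qed

lemma length_morph_gt:
  assumes ne: "\<forall>b. \<phi> b \<noteq> []" and a: "\<phi> a = a # u" "u \<noteq> []" and x: "x 0 = a"
  shows "Suc n < length (morph \<phi> (x [0 \<rightarrow> Suc n]))"
proof -
  have "morph \<phi> (x [0 \<rightarrow> Suc n]) = \<phi> a @ morph \<phi> (x [1 \<rightarrow> Suc n])"
    using subsequence_split[of 1 "Suc n" x] x by (simp add: morph_append morph_def subsequence_def)
  moreover have "length (x [1 \<rightarrow> Suc n]) \<le> length (morph \<phi> (x [1 \<rightarrow> Suc n]))"
    by (rule length_morph_ge) (rule ne)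
  moreover have "0 < length u" using a by simp
  moreover have "length (x [1 \<rightarrow> Suc n]) = n" by simp
  ultimately show ?thesis
    unfolding \<open>morph \<phi> (x [0 \<rightarrow> Suc n]) = _\<close> length_append a(1) list.size by linarith
qed

lemma fixed_point_unique:
  assumes ne: "\<forall>b. \<phi> b \<noteq> []" and a: "\<phi> a = a # u" "u \<noteq> []"
    and x: "x 0 = a" "is_morphic_image \<phi> x x" and y: "y 0 = a" "is_morphic_image \<phi> y y"
  shows "x = y"
proof -
  have "x [0 \<rightarrow> Suc n] = y [0 \<rightarrow> Suc n]" for n
  proof (induction n)
    case 0
    then show ?case using x y by (simp add: subsequence_def)
  next
    case (Suc n)
    let ?l = "length (morph \<phi> (x [0 \<rightarrow> Suc n]))"
    have l: "Suc (Suc n) \<le> ?l"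
      using length_morph_gt[of \<phi> a u x n, OF ne a x(1)] by simp
    have "x [0 \<rightarrow> ?l] = y [0 \<rightarrow> ?l]"
      using morph_prefix_of_fixed_point[OF x(2), of "Suc n"]
        morph_prefix_of_fixed_point[OF y(2), of "Suc n"] Suc by simp
    then have "take (Suc (Suc n)) (x [0 \<rightarrow> ?l]) = take (Suc (Suc n)) (y [0 \<rightarrow> ?l])" by simp
    then show ?case using l by (simp add: subsequence_def take_map min_def del: upt_Suc)
  qed
  then have "x n = y n" for n
    by (metis add_0 diff_zero lessI subsequence_nth)
  then show ?thesis by blast
qed

lemma fixed_point_exists:
  assumes ne: "\<forall>b. \<phi> b \<noteq> []" and a: "\<phi> a = a # u" "u \<noteq> []"
  shows "\<exists>x. x 0 = a \<and> is_morphic_image \<phi> x x"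
proof -
  define w where "w n = (morph \<phi> ^^ n) [a]" for n
  have w0: "w 0 = [a]" and wS: "\<And>n. w (Suc n) = morph \<phi> (w n)"
    by (simp_all add: w_def)
  have step: "\<exists>v. w (Suc n) = w n @ v \<and> v \<noteq> []" for n
  proof (induction n)
    case 0
    then show ?case using a by (simp add: w0 wS morph_def)
  next
    case (Suc n)
    then obtain v where v: "w (Suc n) = w n @ v" "v \<noteq> []" by blast
    have "w (Suc (Suc n)) = w (Suc n) @ morph \<phi> v"
      by (metis v(1) wS morph_append)
    moreover have "morph \<phi> v \<noteq> []" using length_morph_ge[of \<phi> v] ne v(2) by auto
    ultimately show ?case by blast
  qed
  have len: "n < length (w n)" for n
  proof (induction n)
    case (Suc n)
    obtain v where "w (Suc n) = w n @ v" "v \<noteq> []" using step by blast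
    then have "length (w n) < length (w (Suc n))" by simp
    then show ?case using Suc by simp
  qed (simp add: w0)
  have mono: "m \<le> n \<Longrightarrow> \<exists>v. w n = w m @ v" for m n
  proof (induction n rule: dec_induct)
    case (step n)
    then show ?case using \<open>\<And>n. \<exists>v. w (Suc n) = w n @ v \<and> v \<noteq> []\<close>
      by (metis append.assoc)
  qed simp
  define x where "x n = w n ! n" for n
  have nth: "x i = w n ! i" if "i < length (w n)" for i n
  proof (cases "i \<le> n")
    case True
    then show ?thesis using mono[of i n] len[of i] by (auto simp: x_def nth_append)
  next
    case False
    then show ?thesis using mono[of n i] that by (auto simp: x_def nth_append)
  qed
  have pre: "x [0 \<rightarrow> k] = take k (w n)" if "k \<le> length (w n)" for k n
    using that nth[of _ n] by (intro nth_equalityI) (auto simp: subsequence_def)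
  have "take k (morph \<phi> (x [0 \<rightarrow> length (w k)])) = x [0 \<rightarrow> k]" for k
    using pre[of "length (w k)" k] pre[of k "Suc k"] len[of "Suc k"] by (simp add: wS)
  then have "is_morphic_image \<phi> x x"
    unfolding is_morphic_image_def by blast
  moreover have "x 0 = a" by (simp add: x_def w0)
  ultimately show ?thesis by blast
qed

theorem morphic_fixed_point:
  assumes "\<forall>b. \<phi> b \<noteq> []" and "\<phi> a = a # u" "u \<noteq> []"
  shows "morphic_fixed_point \<phi> a 0 = a"
    and "is_morphic_image \<phi> (morphic_fixed_point \<phi> a) (morphic_fixed_point \<phi> a)"
    and "x 0 = a \<Longrightarrow> is_morphic_image \<phi> x x \<Longrightarrow> morphic_fixed_point \<phi> a = x"
proof -
  have ex1: "\<exists>!x. x 0 = a \<and> is_morphic_image \<phi> x x"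
    using fixed_point_exists[of \<phi> a u, OF assms] fixed_point_unique[of \<phi> a u, OF assms] by blast
  show "morphic_fixed_point \<phi> a 0 = a"
    and "is_morphic_image \<phi> (morphic_fixed_point \<phi> a) (morphic_fixed_point \<phi> a)"
    using theI'[OF ex1] by (simp_all add: morphic_fixed_point_def)
  show "morphic_fixed_point \<phi> a = x" if "x 0 = a" "is_morphic_image \<phi> x x"
    unfolding morphic_fixed_point_def using ex1 that by (intro the1_equality) auto
qed


text \<open>
  The alphabets are initial segments of the natural numbers. In each of the morphisms below the
  last case is also used for the numbers outside the alphabet; these do not occur in the fixed
  points considered.
\<close>

definition thue_morse_morphism :: "nat \<Rightarrow> nat list"
  where "thue_morse_morphism a = (if a = 0 then [0, 1] else [1, 0])"

definition thue_morse :: "nat word"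
  where "thue_morse = morphic_fixed_point thue_morse_morphism 0"

definition rudin_shapiro_morphism :: "nat \<Rightarrow> nat list"
  where "rudin_shapiro_morphism a =
    (if a = 0 then [0, 1] else if a = 1 then [0, 2] else if a = 2 then [3, 1] else [3, 2])"

definition rudin_shapiro :: "nat word"
  where "rudin_shapiro = (\<lambda>n. n div 2) \<circ> morphic_fixed_point rudin_shapiro_morphism 0"

function paperfolding :: "nat word" where
  "paperfolding (2 * n + 1) = paperfolding n"
| "paperfolding (4 * n) = 0"
| "paperfolding (4 * n + 2) = 1"
proof -
  fix P :: bool and m :: nat
  assume *: "\<And>n. m = 2 * n + 1 \<Longrightarrow> P" "\<And>n. m = 4 * n \<Longrightarrow> P" "\<And>n. m = 4 * n + 2 \<Longrightarrow> P"
  have "(\<exists>n. m = 2 * n + 1) \<or> (\<exists>n. m = 4 * n) \<or> (\<exists>n. m = 4 * n + 2)" by presburger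
  with * show P by blast
qed (simp_all, presburger+)
termination by (relation "measure id") auto

definition period_doubling_morphism :: "nat \<Rightarrow> nat list"
  where "period_doubling_morphism a = (if a = 1 then [1, 0] else [1, 1])"

definition period_doubling :: "nat word"
  where "period_doubling = morphic_fixed_point period_doubling_morphism 1"

definition fibonacci_morphism :: "nat \<Rightarrow> nat list"
  where "fibonacci_morphism a = (if a = 0 then [0, 1] else [0])"

definition fibonacci :: "nat word"
  where "fibonacci = morphic_fixed_point fibonacci_morphism 0"

lemma thue_morse_fixed_point:
  "thue_morse 0 = 0" "is_morphic_image thue_morse_morphism thue_morse thue_morse"
  using morphic_fixed_point(1,2)[of thue_morse_morphism 0 "[1]"]
  by (simp_all add: thue_morse_def thue_morse_morphism_def)

lemma rudin_shapiro_fixed_point: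
  defines "r \<equiv> morphic_fixed_point rudin_shapiro_morphism 0"
  shows "r 0 = 0" "is_morphic_image rudin_shapiro_morphism r r" "rudin_shapiro n = r n div 2"
  using morphic_fixed_point(1,2)[of rudin_shapiro_morphism 0 "[1]"]
  by (simp_all add: r_def rudin_shapiro_def rudin_shapiro_morphism_def)

lemma period_doubling_fixed_point:
  "period_doubling 0 = 1" "is_morphic_image period_doubling_morphism period_doubling period_doubling"
  using morphic_fixed_point(1,2)[of period_doubling_morphism 1 "[0]"]
  by (simp_all add: period_doubling_def period_doubling_morphism_def)

lemma fibonacci_fixed_point:
  "fibonacci 0 = 0" "is_morphic_image fibonacci_morphism fibonacci fibonacci"
  using morphic_fixed_point(1,2)[of fibonacci_morphism 0 "[1]"]
  by (simp_all add: fibonacci_def fibonacci_morphism_def)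

end

theory Submission
  imports Defs
begin

text \<open>
  Prepending a letter to a word creates at most one new palindromic factor, the longest
  palindromic prefix of the new word. So a word has at most one palindromic factor more than it
  has letters, richness passes to factors, and it can be tested letter by letter.

  The Thue-Morse and Rudin-Shapiro sequences and, after pairing \<open>p\<^sub>n\<close> with \<open>n mod 2\<close>, the
  paperfolding sequence are codings of fixed points of 2-uniform morphisms \<open>\<phi>\<close>. All their factors of
  length at most \<open>2\<^sup>k + 1\<close> occur in the images under \<open>\<phi>\<^sup>k\<close> of the factors of length 2,
  which leaves a finite search: if no rich factor there has length \<open>2\<^sup>k + 1\<close>, there are no
  longer ones.

  The period-doubling and Fibonacci morphisms map every letter to \<open>c q\<close> with a fixed letter \<open>c\<close> and
  a palindrome \<open>q\<close>. If \<open>p\<close> is a palindromic suffix of \<open>w a\<close> that does not occur in \<open>w\<close>,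
  then \<open>\<phi>(p) c\<close>, and if \<open>\<phi>(a)\<close> has length 2 also \<open>c\<^sup>-\<^sup>1 \<phi>(p)\<close>, is a palindrome of \<open>\<phi>(w a) c\<close> that
  is new compared with \<open>\<phi>(w) c\<close>. (If \<open>\<phi>\<close> is the period-doubling morphism and \<open>p\<close> is a power of
  \<open>0\<close>, use \<open>\<phi>(p)\<close> instead of \<open>c\<^sup>-\<^sup>1 \<phi>(p)\<close>.) Hence \<open>\<phi>(w) c\<close> is rich if \<open>w\<close> is, and all prefixes
  of the fixed point are rich by induction.
\<close>

hide_const (open) Omega_Words_Fun.prefix Omega_Words_Fun.suffix

section \<open>Palindromic factors and rich words\<close>

definition pal_factors :: "'a list \<Rightarrow> 'a list set"
  where "pal_factors w = {p. sublist p w \<and> palindrome p}"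

lemma finite_pal_factors [simp]: "finite (pal_factors w)"
  by (rule finite_subset[of _ "{p. sublist p w}"]) (auto simp: pal_factors_def simp flip: set_sublists_eq)

lemma rich_iff: "rich w \<longleftrightarrow> card (pal_factors w) = length w + 1"
  by (simp add: rich_def pal_factors_def)

lemma pal_factors_mono: "sublist v w \<Longrightarrow> pal_factors v \<subseteq> pal_factors w"
  by (auto simp: pal_factors_def dest: sublist_order.order_trans)

lemma pal_factors_rev: "pal_factors (rev w) = pal_factors w"
proof -
  have "sublist p (rev w) \<longleftrightarrow> sublist p w" if "palindrome p" for p
    using that by (metis palindrome_def sublist_rev)
  then show ?thesis by (auto simp: pal_factors_def)
qed

lemma rich_rev: "rich (rev w) \<longleftrightarrow> rich w"
  by (simp add: rich_iff pal_factors_rev)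

lemma pal_factors_Nil [simp]: "pal_factors [] = {[]}"
  by (auto simp: pal_factors_def palindrome_def)

lemma rich_Nil: "rich []"
  by (simp add: rich_iff)

text \<open>The shorter palindrome is also a suffix of the longer one.\<close>

lemma pal_prefix_shorter:
  assumes "prefix p (a # w)" "palindrome p" "prefix q (a # w)" "palindrome q"
    and len: "length p < length q"
  shows "sublist p w"
proof -
  have "prefix p q" using assms by (metis less_imp_le prefix_length_prefix)
  then have "suffix p q" using assms(2,4) by (simp add: suffix_to_prefix palindrome_def)
  then obtain v where v: "q = v @ p" by (auto simp: Sublist.suffix_def)
  with len obtain b v' where "v = b # v'" by (cases v) auto
  moreover obtain u where "a # w = q @ u" using assms(3) by (auto simp: prefix_def)
  ultimately have "w = v' @ p @ u" using v by simp
  then show ?thesis by (auto simp: sublist_def)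
qed

lemma new_pal_factor_unique:
  assumes "p \<in> pal_factors (a # w) - pal_factors w" "q \<in> pal_factors (a # w) - pal_factors w"
  shows "p = q"
proof -
  have p: "prefix p (a # w)" "palindrome p" "\<not> sublist p w"
    and q: "prefix q (a # w)" "palindrome q" "\<not> sublist q w"
    using assms by (auto simp: pal_factors_def sublist_Cons_right)
  then have "length p = length q"
    using pal_prefix_shorter by (metis linorder_neqE_nat)
  then show ?thesis using p(1) q(1) by (metis prefix_length_prefix prefix_order.antisym order_refl)
qed

lemma card_pal_factors_Cons:
  "card (pal_factors (a # w)) =
    card (pal_factors w) + (if pal_factors (a # w) \<subseteq> pal_factors w then 0 else 1)"
proof -
  have sub: "pal_factors w \<subseteq> pal_factors (a # w)"
    by (rule pal_factors_mono) (simp add: sublist_Cons_right)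
  show ?thesis
  proof (cases "pal_factors (a # w) \<subseteq> pal_factors w")
    case True
    then show ?thesis using sub by (simp add: subset_antisym)
  next
    case False
    then obtain p where p: "p \<in> pal_factors (a # w) - pal_factors w" by blast
    then have "pal_factors (a # w) = insert p (pal_factors w)"
      using sub new_pal_factor_unique[of _ a w p] by blast
    then show ?thesis using False p by simp
  qed
qed

lemma card_pal_factors_le: "card (pal_factors w) \<le> length w + 1"
  by (induction w) (simp_all add: card_pal_factors_Cons)

text \<open>A deficit of palindromes in \<open>w\<close> cannot be made up later, since each letter
  adds at most one.\<close>

lemma rich_Cons:
  "rich (a # w) \<longleftrightarrow> rich w \<and> (\<exists>p. prefix p (a # w) \<and> palindrome p \<and> \<not> sublist p w)"
proof -
  have "\<not> pal_factors (a # w) \<subseteq> pal_factors w \<longleftrightarrow>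
      (\<exists>p. prefix p (a # w) \<and> palindrome p \<and> \<not> sublist p w)"
    by (auto simp: pal_factors_def sublist_Cons_right)
  then show ?thesis
    using card_pal_factors_le[of w] by (auto simp: rich_iff card_pal_factors_Cons)
qed

lemma rich_appendD: "rich (u @ v) \<Longrightarrow> rich v"
  by (induction u) (auto simp: rich_Cons)

lemma rich_sublist:
  assumes "rich w" "sublist v w"
  shows "rich v"
proof -
  obtain s t where "w = s @ v @ t" using assms(2) by (auto simp: sublist_def)
  then have "rich (v @ t)" using assms(1) rich_appendD by blast
  then have "rich (rev t @ rev v)" using rich_rev[of "v @ t"] by simp
  then show ?thesis using rich_appendD rich_rev by blast
qed

lemma rich_snocD:
  assumes "rich (w @ [a])"
  obtains p where "suffix p (w @ [a])" "palindrome p" "\<not> sublist p w"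
proof -
  have "rich (a # rev w)" using assms rich_rev[of "w @ [a]"] by simp
  then obtain p where p: "prefix p (a # rev w)" "palindrome p" "\<not> sublist p (rev w)"
    by (auto simp: rich_Cons)
  then have "suffix p (w @ [a])" by (simp add: suffix_to_prefix palindrome_def)
  moreover have "\<not> sublist p w" using p by (metis palindrome_def sublist_rev)
  ultimately show ?thesis using that p(2) by blast
qed

text \<open>The palindromes in \<open>P\<close> give a lower bound that meets the upper bound
  \<open>card_pal_factors_le\<close>.\<close>

lemma rich_append:
  assumes "rich v" "P \<subseteq> pal_factors (v @ u) - pal_factors v" "card P = length u"
  shows "rich (v @ u)"
proof -
  have fin: "finite P" using assms(2) by (rule finite_subset) simp
  have "card (pal_factors v \<union> P) \<le> card (pal_factors (v @ u))"
    using assms(2) pal_factors_mono[of v "v @ u"] by (intro card_mono) auto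
  moreover have "card (pal_factors v \<union> P) = card (pal_factors v) + card P"
    using assms(2) fin by (intro card_Un_disjoint) auto
  ultimately show ?thesis
    using assms(1,3) card_pal_factors_le[of "v @ u"] by (simp add: rich_iff)
qed

section \<open>Enumerating rich words\<close>

text \<open>Meant for \<open>t = rev w\<close>: the suffixes of \<open>t\<close> are then the
  reversed prefixes of \<open>w\<close>, tried from the longest down, so that the result is the
  longest palindromic prefix of \<open>w\<close>.\<close>

fun pal_prefix :: "'a list \<Rightarrow> 'a list \<Rightarrow> 'a list" where
  "pal_prefix [] w = []"
| "pal_prefix (b # t) w = (if prefix (b # t) w then b # t else pal_prefix t w)"

lemma pal_prefix_suffix: "suffix (pal_prefix t w) t"
  by (induction t) (auto simp: suffix_Cons)

lemma pal_prefix_prefix: "prefix (pal_prefix t w) w"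
  by (induction t) auto

lemma pal_prefix_longest: "suffix p t \<Longrightarrow> prefix p w \<Longrightarrow> length p \<le> length (pal_prefix t w)"
  by (induction t) (auto simp: suffix_Cons dest: suffix_length_le)

lemma pal_prefix_rev_palindrome: "palindrome (pal_prefix (rev w) w)"
proof -
  let ?q = "pal_prefix (rev w) w"
  have "prefix (rev ?q) w" using pal_prefix_suffix[of "rev w" w] by (simp add: suffix_to_prefix)
  then show ?thesis unfolding palindrome_def
    using pal_prefix_prefix[of "rev w" w]
    by (metis length_rev order_refl prefix_length_prefix prefix_order.antisym)
qed

text \<open>An executable test: shorter palindromic prefixes recur in \<open>w\<close>, so only the
  longest one can be new.\<close>

lemma rich_Cons_code:
  "rich (a # w) \<longleftrightarrow> rich w \<and> \<not> sublist (pal_prefix (rev (a # w)) (a # w)) w"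
proof -
  let ?q = "pal_prefix (rev (a # w)) (a # w)"
  have q: "prefix ?q (a # w)" "palindrome ?q"
    by (rule pal_prefix_prefix, rule pal_prefix_rev_palindrome)
  have "p = ?q" if p: "prefix p (a # w)" "palindrome p" "\<not> sublist p w" for p
  proof -
    have "length p \<le> length ?q"
      using p by (intro pal_prefix_longest) (auto simp: suffix_to_prefix palindrome_def)
    moreover have "\<not> length p < length ?q"
      using pal_prefix_shorter[OF p(1,2) q] p(3) by blast
    ultimately have "length p = length ?q" by simp
    then show ?thesis using p(1) q(1)
      by (metis prefix_length_prefix prefix_order.antisym order_refl)
  qed
  then show ?thesis using q by (metis rich_Cons)
qed

section \<open>Binary tries as sets of words\<close>

datatype trie = Empty | Node trie trie

text \<open>Each \<open>Node\<close> stands for exactly one word, so the number of nodes is the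
  cardinality. The sets represented are prefix-closed, as are the sets of factors and of rich
  words.\<close>

fun paths :: "trie \<Rightarrow> nat list set" where
  "paths Empty = {}"
| "paths (Node s t) = insert [] ((#) 0 ` paths s \<union> (#) 1 ` paths t)"

lemma finite_paths [simp]: "finite (paths t)"
  by (induction t) auto

fun prefix_trie :: "nat list \<Rightarrow> trie" where
  "prefix_trie [] = Node Empty Empty"
| "prefix_trie (a # w) = (if a = 0 then Node (prefix_trie w) Empty else Node Empty (prefix_trie w))"

lemma paths_prefix_trie: "set w \<subseteq> {0, 1} \<Longrightarrow> paths (prefix_trie w) = {u. prefix u w}"
  by (induction w) (auto simp: prefix_Cons)

fun merge :: "trie \<Rightarrow> trie \<Rightarrow> trie" where
  "merge Empty t = t"
| "merge (Node s t) Empty = Node s t"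
| "merge (Node s t) (Node s' t') = Node (merge s s') (merge t t')"

lemma paths_merge: "paths (merge s t) = paths s \<union> paths t"
  by (induction s t rule: merge.induct) auto

fun factor_trie :: "nat list \<Rightarrow> trie" where
  "factor_trie [] = Node Empty Empty"
| "factor_trie (a # w) = merge (prefix_trie (a # w)) (factor_trie w)"

lemma paths_factor_trie: "set w \<subseteq> {0, 1} \<Longrightarrow> paths (factor_trie w) = {u. sublist u w}"
proof (induction w)
  case (Cons a w)
  then show ?case
    using paths_prefix_trie[of "a # w"] by (auto simp: paths_merge sublist_Cons_right simp del: prefix_trie.simps)
qed simp

fun factors_trie :: "nat list list \<Rightarrow> trie" where
  "factors_trie [] = Empty"
| "factors_trie (w # ws) = merge (factor_trie w) (factors_trie ws)"

lemma paths_factors_trie: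
  "\<forall>w \<in> set ws. set w \<subseteq> {0, 1} \<Longrightarrow> paths (factors_trie ws) = {u. \<exists>w \<in> set ws. sublist u w}"
  by (induction ws) (auto simp: paths_merge paths_factor_trie)

text \<open>The word \<open>r\<close> read on the way from the root is stored in reverse.\<close>

fun rich_trie :: "nat list \<Rightarrow> trie \<Rightarrow> trie"
  and rich_branch :: "nat list \<Rightarrow> trie \<Rightarrow> trie" where
  "rich_trie r Empty = Empty"
| "rich_trie r (Node s t) = Node (rich_branch (0 # r) s) (rich_branch (1 # r) t)"
| "rich_branch r Empty = Empty"
| "rich_branch r (Node s t) =
    (if sublist (pal_prefix (rev r) r) (tl r) then Empty else rich_trie r (Node s t))"

text \<open>Cutting off everything below a word that is not rich loses nothing, since richness
  passes to factors. Reversed storage puts each new letter at the head of \<open>r\<close>, where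
  \<open>rich_Cons_code\<close> tests it.\<close>

lemma paths_rich_trie: "rich r \<Longrightarrow> paths (rich_trie r t) = {u \<in> paths t. rich (rev u @ r)}"
proof (induction t arbitrary: r)
  case (Node s t)
  have branch: "paths (rich_branch (a # r) t) = {u \<in> paths t. rich (rev u @ a # r)}"
    if "\<And>r. rich r \<Longrightarrow> paths (rich_trie r t) = {u \<in> paths t. rich (rev u @ r)}" for a t
    using Node.prems that[of "a # r"] rich_appendD[of _ "a # r"]
    by (cases t) (auto simp: rich_Cons_code[of a r] simp del: rich_trie.simps)
  show ?case
    using Node.prems by (auto simp: branch[OF Node.IH(1)] branch[OF Node.IH(2)])
qed simp

primrec card_height :: "trie \<Rightarrow> nat \<times> nat" where
  "card_height Empty = (0, 0)"
| "card_height (Node s t) =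
    (case card_height s of (m, i) \<Rightarrow> case card_height t of (n, j) \<Rightarrow> (m + n + 1, max i j + 1))"

text \<open>The height counts nodes, hence is one more than the maximal word length.\<close>

lemma card_height:
  "card_height t = (m, h) \<Longrightarrow> card (paths t) = m \<and> (\<forall>u \<in> paths t. length u < h) \<and>
    (t \<noteq> Empty \<longrightarrow> (\<exists>u \<in> paths t. Suc (length u) = h))"
proof (induction t arbitrary: m h)
  case (Node s t)
  obtain m1 h1 m2 h2 where mh: "card_height s = (m1, h1)" "card_height t = (m2, h2)" by fastforce
  note IH = Node.IH(1)[OF mh(1)] Node.IH(2)[OF mh(2)]
  have h: "m = m1 + m2 + 1" "h = max h1 h2 + 1" using Node.prems mh by auto
  have "card (paths (Node s t)) = m"
  proof -
    have "card ((#) 0 ` paths s \<union> (#) 1 ` paths t) = card (paths s) + card (paths t)"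
      by (subst card_Un_disjoint) (auto simp: card_image)
    then show ?thesis using IH h by (simp, subst card_insert_disjoint) auto
  qed
  moreover have "\<forall>u \<in> paths (Node s t). length u < h"
    using IH h by (auto simp: less_max_iff_disj)
  moreover have "\<exists>u \<in> paths (Node s t). Suc (length u) = h"
  proof (cases "s = Empty \<and> t = Empty")
    case True
    then show ?thesis using h mh by auto
  next
    case False
    then consider "s \<noteq> Empty" "h = h1 + 1" | "t \<noteq> Empty" "h = h2 + 1"
      using h mh by (cases "h2 \<le> h1"; cases s; cases t) (auto simp: max_def)
    then show ?thesis
    proof cases
      case 1
      then obtain u where "u \<in> paths s" "Suc (length u) = h1" using IH by blast
      then show ?thesis using 1 by (intro bexI[of _ "0 # u"]) auto
    next
      case 2
      then obtain u where "u \<in> paths t" "Suc (length u) = h2" using IH by blast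
      then show ?thesis using 2 by (intro bexI[of _ "1 # u"]) auto
    qed
  qed
  ultimately show ?case by blast
qed simp

section \<open>Words generated by 2-uniform morphisms\<close>

lemma is_factor_sublist:
  assumes "is_factor w x" "sublist v w"
  shows "is_factor v x"
proof -
  obtain i j where w: "w = x [i \<rightarrow> j]" using assms(1) by (auto simp: is_factor_def)
  obtain s t where st: "w = s @ v @ t" using assms(2) by (auto simp: sublist_def)
  have "v = x [i + length s \<rightarrow> i + length s + length v]"
  proof (cases "v = []")
    case False
    have "length s + length v \<le> j - i" using arg_cong[OF st, of length] w by simp
    \<comment> \<open>A nonempty \<open>v\<close> forces \<open>i < j\<close>, so the difference
      \<open>j - i\<close> is not truncated.\<close>
    then have "i + length s + length v \<le> j" using False by (cases v) auto
    moreover have "v = take (length v) (drop (length s) w)" using st by simp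
    ultimately show ?thesis
      unfolding w by (simp add: subsequence_def drop_map take_map)
  qed simp
  then show ?thesis by (auto simp: is_factor_def)
qed

lemma is_factor_subsequence: "is_factor (x [i \<rightarrow> j]) x"
  by (auto simp: is_factor_def)

lemma is_factor_Nil: "is_factor [] x"
  using is_factor_subsequence[of x 0 0] by simp

lemma sublist_map: "sublist u v \<Longrightarrow> sublist (map f u) (map f v)"
  by (metis map_append sublist_def)

lemma map_subsequence: "map f (x [i \<rightarrow> j]) = (f \<circ> x) [i \<rightarrow> j]"
  by (simp add: subsequence_def)

lemma subsequence_sublist:
  assumes "a \<le> i" "j \<le> b"
  shows "sublist (x [i \<rightarrow> j]) (x [a \<rightarrow> b])"
proof -
  have "x [i \<rightarrow> j] = take (j - i) (drop (i - a) (x [a \<rightarrow> b]))"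
    using assms by (cases "i \<le> j") simp_all
  then show ?thesis by (metis sublist_drop sublist_take sublist_order.order_trans)
qed

text \<open>Stated along the letters of \<open>x\<close> instead of through
  \<open>is_morphic_image\<close>, so that the paperfolding recurrences yield it directly.\<close>

definition uniform2 :: "('a \<Rightarrow> 'a list) \<Rightarrow> 'a word \<Rightarrow> bool"
  where "uniform2 \<phi> x \<longleftrightarrow> (\<forall>n. \<phi> (x n) = [x (2 * n), x (2 * n + 1)])"

lemma uniform2_morph:
  assumes "uniform2 \<phi> x"
  shows "morph \<phi> (x [i \<rightarrow> j]) = x [2 * i \<rightarrow> 2 * j]"
proof (induction j)
  case 0
  then show ?case by (simp add: morph_def)
next
  case (Suc j)
  show ?case
  proof (cases "i \<le> j")
    case True
    then have "morph \<phi> (x [i \<rightarrow> Suc j]) = x [2 * i \<rightarrow> 2 * j] @ \<phi> (x j)"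
      by (simp add: morph_append Suc) (simp add: morph_def)
    then show ?thesis using True assms by (simp add: uniform2_def)
  qed (simp add: morph_def)
qed

lemma uniform2_morph_pow:
  assumes "uniform2 \<phi> x"
  shows "(morph \<phi> ^^ k) (x [i \<rightarrow> j]) = x [2 ^ k * i \<rightarrow> 2 ^ k * j]"
  by (induction k) (simp_all add: uniform2_morph[OF assms] mult.assoc)

lemma uniform2I:
  assumes "is_morphic_image \<phi> x x" "\<And>b. length (\<phi> b) = 2"
  shows "uniform2 \<phi> x"
  unfolding uniform2_def
proof
  fix n
  have len: "length (morph \<phi> w) = 2 * length w" for w
    by (induction w) (simp_all add: morph_def assms(2))
  have m: "morph \<phi> (x [0 \<rightarrow> n]) = x [0 \<rightarrow> 2 * n]" for n
    using morph_prefix_of_fixed_point[OF assms(1), of n] by (simp add: len)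
  have "x [0 \<rightarrow> 2 * n] @ \<phi> (x n) = morph \<phi> (x [0 \<rightarrow> Suc n])"
    by (simp add: morph_append m) (simp add: morph_def)
  also have "\<dots> = x [0 \<rightarrow> 2 * n] @ [x (2 * n), x (2 * n + 1)]"
    by (simp only: m) simp
  finally show "\<phi> (x n) = [x (2 * n), x (2 * n + 1)]" by simp
qed

text \<open>The pair at position \<open>n\<close> lies in the image of the pair at position
  \<open>n div 2\<close>, at offset 0 or 1.\<close>

lemma uniform2_pairs:
  assumes x: "uniform2 \<phi> x" and "x [0 \<rightarrow> 2] \<in> S"
    and S: "\<forall>u \<in> S. take 2 (morph \<phi> u) \<in> S \<and> take 2 (drop 1 (morph \<phi> u)) \<in> S"
  shows "x [n \<rightarrow> n + 2] \<in> S"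
proof (induction n rule: less_induct)
  case (less n)
  show ?case
  \<comment> \<open>0 is its own half, so the first pair is the base of the induction.\<close>
  proof (cases "n = 0")
    case True
    then show ?thesis using assms(2) by (simp only: add_0)
  next
    case False
    define m where "m = n div 2"
    have "x [m \<rightarrow> m + 2] \<in> S" using less False by (simp add: m_def)
    moreover have "morph \<phi> (x [m \<rightarrow> m + 2]) = x [2 * m \<rightarrow> 2 * m + 4]"
      unfolding uniform2_morph[OF x] by (simp only: distrib_left) simp
    ultimately have "take 2 (x [2 * m \<rightarrow> 2 * m + 4]) \<in> S"
        "take 2 (drop 1 (x [2 * m \<rightarrow> 2 * m + 4])) \<in> S"
      using S by metis+
    then have "x [2 * m \<rightarrow> 2 * m + 2] \<in> S" "x [2 * m + 1 \<rightarrow> 2 * m + 1 + 2] \<in> S"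
      by (simp_all add: min_def del: subseq_to_Suc)
    moreover have "n = 2 * m \<or> n = 2 * m + 1" by (auto simp: m_def)
    ultimately show ?thesis by auto
  qed
qed

text \<open>A factor starts at the latest at the last position of a block of length
  \<open>2 ^ k\<close>; the \<open>2 ^ k\<close> letters after that position reach at most the end
  of the next block.\<close>

lemma uniform2_block:
  assumes x: "uniform2 \<phi> x" and "is_factor w x" "length w \<le> 2 ^ k + 1"
  shows "\<exists>n. sublist w ((morph \<phi> ^^ k) (x [n \<rightarrow> n + 2]))"
proof -
  obtain i j where w: "w = x [i \<rightarrow> j]" using assms(2) by (auto simp: is_factor_def)
  define n where "n = i div 2 ^ k"
  have n: "2 ^ k * n \<le> i" "i < 2 ^ k * n + 2 ^ k"
    by (simp_all add: n_def) (metis add.commute dividend_less_times_div mult.commute zero_less_numeral zero_less_power)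
  have "j \<le> i \<or> j \<le> 2 ^ k * (n + 2)"
    using assms(3) n(2) w by (simp add: distrib_left) linarith
  then have "sublist w (x [2 ^ k * n \<rightarrow> 2 ^ k * (n + 2)])"
    using n(1) w subsequence_sublist by (metis sublist_Nil_left subseq_to_smaller)
  then show ?thesis using uniform2_morph_pow[OF x] by metis
qed

text \<open>Closure under windows puts all pairs of adjacent letters of \<open>x\<close> into
  \<open>S\<close>, and \<open>occ\<close> ensures that every member of \<open>S\<close> occurs in
  \<open>x\<close>. So the trie in \<open>comp\<close> holds rich factors of
  \<open>c \<circ> x\<close> only, and all those of length at most \<open>2 ^ k + 1\<close>.\<close>

lemma uniform2_rich_factors:
  fixes c :: "'a \<Rightarrow> nat"
  assumes x: "uniform2 \<phi> x" and x0: "x 0 = a" "x 1 = b" and ab: "[a, b] \<in> set S"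
    and S: "list_all (\<lambda>u. take 2 (morph \<phi> u) \<in> set S \<and> take 2 (drop 1 (morph \<phi> u)) \<in> set S) S"
    and occ: "list_all (\<lambda>u. sublist u ((morph \<phi> ^^ l) [a])) S"
    and letters: "list_all (\<lambda>u. list_all (\<lambda>b. b = 0 \<or> b = 1) (map c ((morph \<phi> ^^ k) u))) S"
    and comp: "card_height (rich_trie [] (factors_trie (map (\<lambda>u. map c ((morph \<phi> ^^ k) u)) S))) = (N, Suc M)"
    and bound: "M \<le> 2 ^ k"
  shows "card (rich_factors (c \<circ> x)) = N \<and> Max (length ` rich_factors (c \<circ> x)) = M"
proof -
  let ?B = "\<lambda>u. map c ((morph \<phi> ^^ k) u)"
  let ?T = "rich_trie [] (factors_trie (map ?B S))"
  have "\<forall>w \<in> set (map ?B S). set w \<subseteq> {0, 1}"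
    using letters by (simp add: list_all_iff image_subset_iff)
  then have W: "paths ?T = {u. rich u \<and> (\<exists>v \<in> set S. sublist u (?B v))}"
    by (auto simp: paths_rich_trie[OF rich_Nil] paths_factors_trie rich_rev)
  have T: "card (paths ?T) = N" "\<And>u. u \<in> paths ?T \<Longrightarrow> length u \<le> M"
    "?T \<noteq> Empty \<Longrightarrow> \<exists>u \<in> paths ?T. length u = M"
    using card_height[OF comp] by (auto simp: less_Suc_eq_le)
  have pairs: "x [n \<rightarrow> n + 2] \<in> set S" for n
    by (rule uniform2_pairs[OF x]) (use x0 ab S in \<open>auto simp: list_all_iff numeral_2_eq_2\<close>)
  have short: "u \<in> paths ?T"
    if factor: "is_factor u (c \<circ> x)" and "rich u" and len: "length u \<le> 2 ^ k + 1" for u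
  proof -
    obtain i j where u: "u = map c (x [i \<rightarrow> j])"
      using factor unfolding is_factor_def map_subsequence by blast
    have "length (x [i \<rightarrow> j]) \<le> 2 ^ k + 1" using len unfolding u by simp
    from uniform2_block[OF x is_factor_subsequence this]
    obtain n where "sublist (x [i \<rightarrow> j]) ((morph \<phi> ^^ k) (x [n \<rightarrow> n + 2]))" by blast
    then have "sublist u (?B (x [n \<rightarrow> n + 2]))" unfolding u by (rule sublist_map)
    then show ?thesis using pairs[of n] \<open>rich u\<close> unfolding W by blast
  qed
  have factor: "is_factor u (c \<circ> x)" if "v \<in> set S" "sublist u (?B v)" for u v
  proof -
    have "(morph \<phi> ^^ l) [a] = x [0 \<rightarrow> 2 ^ l]"
      using uniform2_morph_pow[OF x, of l 0 1] x0 by simp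
    then have "is_factor v x"
      using occ that(1) is_factor_sublist[OF is_factor_subsequence] by (metis list_all_iff)
    then obtain i j where v: "v = x [i \<rightarrow> j]" by (auto simp: is_factor_def)
    have "?B v = (c \<circ> x) [2 ^ k * i \<rightarrow> 2 ^ k * j]"
      unfolding v uniform2_morph_pow[OF x] by (rule map_subsequence)
    then show ?thesis using that(2) is_factor_sublist is_factor_subsequence by metis
  qed
  have "rich_factors (c \<circ> x) = paths ?T"
  proof (rule set_eqI, rule iffI)
    fix u assume "u \<in> rich_factors (c \<circ> x)"
    then have u: "is_factor u (c \<circ> x)" "rich u" by (auto simp: rich_factors_def)
    have "length u \<le> 2 ^ k + 1"
    proof (rule ccontr)
      \<comment> \<open>The prefix of length \<open>2 ^ k + 1\<close> would be a rich word in the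
        trie, whose words have length at most \<open>M\<close>.\<close>
      assume long: "\<not> ?thesis"
      let ?v = "take (2 ^ k + 1) u"
      have "?v \<in> paths ?T"
        using u by (intro short) (auto intro: is_factor_sublist rich_sublist)
      then show False using T(2)[of ?v] long bound by simp
    qed
    then show "u \<in> paths ?T" using short u by blast
  next
    fix u assume "u \<in> paths ?T"
    then show "u \<in> rich_factors (c \<circ> x)"
      unfolding W rich_factors_def using factor by blast
  qed
  \<comment> \<open>The empty word makes the trie nonempty, so the length \<open>M\<close> is
    attained.\<close>
  moreover have "[] \<in> paths ?T" using short[of "[]"] by (simp add: is_factor_Nil rich_Nil)
  then have "Max (length ` paths ?T) = M"
    using T(2,3) by (intro Max_eqI) fastforce+
  ultimately show ?thesis using T(1) by simp
qed

section \<open>The Thue-Morse, Rudin-Shapiro and paperfolding sequences\<close>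

lemma rich_factors_thue_morse:
  "card (rich_factors thue_morse) = 161 \<and> Max (length ` rich_factors thue_morse) = 16"
proof -
  have x: "uniform2 thue_morse_morphism thue_morse"
    by (rule uniform2I) (auto simp: thue_morse_fixed_point thue_morse_morphism_def)
  have "card (rich_factors (id \<circ> thue_morse)) = 161 \<and> Max (length ` rich_factors (id \<circ> thue_morse)) = 16"
  \<comment> \<open>Here \<open>2 ^ 4\<close> is exactly the maximal length 16, and the prefix
    01101001 of length \<open>2 ^ 3\<close> contains all four pairs.\<close>
  proof (rule uniform2_rich_factors[OF x, where k = 4 and l = 3 and S = "[[0, 0], [0, 1], [1, 0], [1, 1]]"])
    show "thue_morse 0 = 0" by (rule thue_morse_fixed_point)
    with x show "thue_morse 1 = 1" by (auto simp: uniform2_def thue_morse_morphism_def dest: spec[of _ 0])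
  qed code_simp+
  then show ?thesis by simp
qed

lemma rich_factors_rudin_shapiro:
  "card (rich_factors rudin_shapiro) = 975 \<and> Max (length ` rich_factors rudin_shapiro) = 30"
proof -
  let ?r = "morphic_fixed_point rudin_shapiro_morphism 0"
  have x: "uniform2 rudin_shapiro_morphism ?r"
    by (rule uniform2I) (auto simp: rudin_shapiro_fixed_point rudin_shapiro_morphism_def)
  show ?thesis
    unfolding rudin_shapiro_def
  \<comment> \<open>\<open>2 ^ 5\<close> is at least 30, and all eight pairs occur among the first
    \<open>2 ^ 4\<close> letters.\<close>
  proof (rule uniform2_rich_factors[OF x, where k = 5 and l = 4
        and S = "[[0, 1], [1, 0], [0, 2], [2, 0], [1, 3], [3, 1], [2, 3], [3, 2]]"])
    show "?r 0 = 0" by (rule rudin_shapiro_fixed_point)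
    with x show "?r 1 = 1" by (auto simp: uniform2_def rudin_shapiro_morphism_def dest: spec[of _ 0])
  qed code_simp+
qed

lemma rich_factors_paperfolding:
  "card (rich_factors paperfolding) = 494 \<and> Max (length ` rich_factors paperfolding) = 23"
proof -
  \<comment> \<open>The term with index \<open>2 * n\<close> is \<open>n mod 2\<close> and the one
    with index \<open>2 * n + 1\<close> is the \<open>n\<close>th term, so term and parity at
    \<open>n\<close> determine both at \<open>2 * n\<close> and \<open>2 * n + 1\<close>.\<close>
  define \<phi> :: "nat \<times> nat \<Rightarrow> (nat \<times> nat) list" where "\<phi> = (\<lambda>(p, e). [(e, 0), (p, 1)])"
  define q where "q n = (paperfolding n, n mod 2)" for n
  have p: "paperfolding (2 * n) = n mod 2" for n
  proof (cases "even n")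
    case True
    then obtain m where "n = 2 * m" by (rule evenE)
    then show ?thesis using paperfolding.simps(2)[of m] by simp
  next
    case False
    then obtain m where "n = 2 * m + 1" by (rule oddE)
    then show ?thesis using paperfolding.simps(3)[of m] by simp
  qed
  have x: "uniform2 \<phi> q"
    by (simp add: uniform2_def q_def \<phi>_def p paperfolding.simps(1)[simplified])
  have "card (rich_factors (fst \<circ> q)) = 494 \<and> Max (length ` rich_factors (fst \<circ> q)) = 23"
    using x unfolding \<phi>_def
  \<comment> \<open>Parities alternate, which leaves these eight pairs.\<close>
  proof (rule uniform2_rich_factors[where k = 5 and l = 4
        and S = "[[(p, 0), (p', 1)]. p \<leftarrow> [0, 1], p' \<leftarrow> [0, 1]] @ [[(p, 1), (p', 0)]. p \<leftarrow> [0, 1], p' \<leftarrow> [0, 1]]"])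
    show "q 0 = (0, 0)" "q 1 = (0, 1)"
      using p[of 0] paperfolding.simps(1)[of 0] by (simp_all add: q_def)
  qed code_simp+
  moreover have "fst \<circ> q = paperfolding" by (auto simp: q_def)
  ultimately show ?thesis by simp
qed

section \<open>Morphisms preserving richness\<close>

lemma fixed_point_letter:
  assumes "is_morphic_image \<phi> x x"
  shows "\<exists>b. x n \<in> set (\<phi> b)"
proof -
  obtain m where m: "take (Suc n) (morph \<phi> (x [0 \<rightarrow> m])) = x [0 \<rightarrow> Suc n]"
    using assms unfolding is_morphic_image_def by blast
  have "x n \<in> set (x [0 \<rightarrow> Suc n])" by simp
  then have "x n \<in> set (morph \<phi> (x [0 \<rightarrow> m]))"
    unfolding m[symmetric] by (rule in_set_takeD)
  then show ?thesis by (auto simp: morph_def)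
qed

text \<open>If \<open>u\<close> is a prefix of \<open>x\<close>, so is
  \<open>morph \<phi> u @ [c]\<close>, because the image of the next letter begins with
  \<open>c\<close>. It is longer than \<open>u\<close>, so richness spreads to ever longer
  prefixes.\<close>

lemma rich_fixed_point:
  assumes x: "is_morphic_image \<phi> x x" and c: "\<And>b. \<exists>q. \<phi> b = c # q"
    and rich: "\<And>w. set w \<subseteq> range x \<Longrightarrow> rich w \<Longrightarrow> rich (morph \<phi> w @ [c])"
    and w: "is_factor w x"
  shows "rich w"
proof -
  have "rich (x [0 \<rightarrow> n])" for n
  proof (induction n)
    case (Suc n)
    let ?u = "x [0 \<rightarrow> n]"
    have ne: "\<forall>b. \<phi> b \<noteq> []" using c by (metis list.distinct(1))
    obtain q where "\<phi> (x n) = c # q" using c by blast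
    then have "morph \<phi> (x [0 \<rightarrow> Suc n]) = (morph \<phi> ?u @ [c]) @ q"
      by (simp add: morph_append) (simp add: morph_def)
    then obtain L where L: "x [0 \<rightarrow> L] = (morph \<phi> ?u @ [c]) @ q"
      using morph_prefix_of_fixed_point[OF x, of "Suc n"] by metis
    have len: "Suc n \<le> length (morph \<phi> ?u @ [c])"
      using length_morph_ge[OF ne, of ?u] by simp
    have "Suc n \<le> L" using len arg_cong[OF L, of length] by simp
    then have "x [0 \<rightarrow> Suc n] = take (Suc n) (x [0 \<rightarrow> L])"
      by (simp add: min_def del: subseq_to_Suc)
    also have "\<dots> = take (Suc n) (morph \<phi> ?u @ [c])"
      unfolding L using len by (simp only: take_append) simp
    finally have "x [0 \<rightarrow> Suc n] = take (Suc n) (morph \<phi> ?u @ [c])" .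
    moreover have "rich (morph \<phi> ?u @ [c])" using Suc by (intro rich) auto
    ultimately show ?case by (metis rich_sublist sublist_take)
  qed (simp add: rich_Nil)
  moreover obtain i j where "w = x [i \<rightarrow> j]" using w by (auto simp: is_factor_def)
  ultimately show ?thesis using rich_sublist subsequence_sublist[of 0 i j j x] by blast
qed

text \<open>Reversal turns each block \<open>c q\<close> into \<open>q c\<close>; the additional
  \<open>c\<close> lets the letters regroup into blocks \<open>c q\<close>.\<close>

lemma rev_morph:
  assumes "\<And>b. \<exists>q. \<phi> b = c # q \<and> rev q = q"
  shows "rev (morph \<phi> w @ [c]) = morph \<phi> (rev w) @ [c]"
proof (induction w)
  case (Cons a w)
  obtain q where q: "\<phi> a = c # q" "rev q = q" using assms by blast
  have "morph \<phi> (a # w) @ [c] = c # q @ (morph \<phi> w @ [c])" using q by (simp add: morph_def)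
  moreover have "morph \<phi> (rev (a # w)) @ [c] = morph \<phi> (rev w) @ [c] @ q @ [c]"
    using q by (simp add: morph_append) (simp add: morph_def)
  ultimately show ?case using Cons q(2) by simp
qed (simp add: morph_def)

text \<open>The second palindrome is the first one without its two outer letters \<open>c\<close>,
  if \<open>p\<close> is nonempty.\<close>

lemma palindrome_morph:
  assumes "\<And>b. \<exists>q. \<phi> b = c # q \<and> rev q = q" "palindrome p"
  shows "palindrome (morph \<phi> p @ [c])" "palindrome (tl (morph \<phi> p))"
proof -
  show *: "palindrome (morph \<phi> p @ [c])"
    using rev_morph[of \<phi> c p, OF assms(1)] assms(2) unfolding palindrome_def by simp
  show "palindrome (tl (morph \<phi> p))"
  proof (cases p)
    case (Cons a p')
    then obtain t where "morph \<phi> p = c # t"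
      using assms(1)[of a] by (auto simp: morph_def)
    then show ?thesis using * by (simp add: palindrome_def)
  qed (simp add: morph_def palindrome_def)
qed

text \<open>Appending \<open>a\<close> to \<open>w\<close> extends
  \<open>morph \<phi> w @ [c]\<close> by \<open>length (\<phi> a)\<close> letters, so this many new
  palindromes are required. The set \<open>A\<close> stands for the alphabet on which images can be
  decoded.\<close>

lemma rich_morph:
  assumes c: "\<And>b. \<exists>q. \<phi> b = c # q"
    and new: "\<And>w a p. set (w @ [a]) \<subseteq> A \<Longrightarrow> suffix p (w @ [a]) \<Longrightarrow> palindrome p \<Longrightarrow> \<not> sublist p w \<Longrightarrow>
      \<exists>P \<subseteq> pal_factors (morph \<phi> (w @ [a]) @ [c]) - pal_factors (morph \<phi> w @ [c]). card P = length (\<phi> a)"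
    and "rich w" "set w \<subseteq> A"
  shows "rich (morph \<phi> w @ [c])"
  using assms(3,4)
proof (induction w rule: rev_induct)
  case Nil
  have "rich [c]" unfolding rich_Cons by (auto simp: rich_Nil palindrome_def intro!: exI[of _ "[c]"])
  then show ?case by (simp add: morph_def)
next
  case (snoc a w)
  obtain q where q: "\<phi> a = c # q" using c by blast
  have split: "morph \<phi> (w @ [a]) @ [c] = (morph \<phi> w @ [c]) @ q @ [c]"
    using q by (simp add: morph_append) (simp add: morph_def)
  obtain p where "suffix p (w @ [a])" "palindrome p" "\<not> sublist p w"
    using rich_snocD[OF snoc.prems(1)] by blast
  from new[OF snoc.prems(2) this] obtain P
    where P: "P \<subseteq> pal_factors ((morph \<phi> w @ [c]) @ q @ [c]) - pal_factors (morph \<phi> w @ [c])"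
      "card P = length (q @ [c])"
    unfolding split using q by auto
  have "rich w" using rich_sublist[OF snoc.prems(1)] by (simp add: sublist_def) blast
  then have "rich (morph \<phi> w @ [c])" using snoc by simp
  then show ?case unfolding split using P by (rule rich_append)
qed

lemma suffix_morph: "suffix p w \<Longrightarrow> suffix (morph \<phi> p @ u) (morph \<phi> w @ u)"
  by (auto simp: Sublist.suffix_def morph_append)

lemma sublist_tl: "sublist (tl u) u"
  by (cases u) (auto simp: sublist_Cons_right)

declare prefix_snoc [simp del]

section \<open>The period-doubling sequence\<close>

abbreviation "pd \<equiv> morph period_doubling_morphism"

text \<open>The second letter of \<open>period_doubling_morphism a\<close>, whose first letter is
  always \<open>1\<close>.\<close>

definition flip :: "nat \<Rightarrow> nat" where "flip a = (if a = 1 then 0 else 1)"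

lemma pd_simps [simp]: "pd [] = []" "pd (a # w) = 1 # flip a # pd w"
  by (simp_all add: morph_def period_doubling_morphism_def flip_def)

lemma flip_eq_1 [simp]: "flip a = Suc 0 \<longleftrightarrow> a \<noteq> Suc 0" "Suc 0 = flip a \<longleftrightarrow> a \<noteq> Suc 0"
  by (auto simp: flip_def)

lemma flip_eqD: "flip a = flip b \<Longrightarrow> a \<in> {0, 1} \<Longrightarrow> b \<in> {0, 1} \<Longrightarrow> a = b"
  by (auto simp: flip_def)

text \<open>Aligned blocks are compared one by one, and \<open>flip\<close> is injective on the
  alphabet. The final \<open>1\<close> is too short to hold a block.\<close>

lemma pd_prefix:
  "set p \<subseteq> {0, 1} \<Longrightarrow> set w \<subseteq> {0, 1} \<Longrightarrow> prefix (pd p) (pd w @ [1]) \<Longrightarrow> prefix p w"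
proof (induction p arbitrary: w)
  case (Cons a p)
  obtain b v where w: "w = b # v" using Cons.prems(3) by (cases w) simp_all
  have "flip a = flip b" and pre: "prefix (pd p) (pd v @ [1])"
    using Cons.prems(3) by (simp_all add: w)
  then have "a = b" using flip_eqD Cons.prems(1,2) w by simp
  moreover have "prefix p v" using Cons.prems(1,2) pre w by (intro Cons.IH) simp_all
  ultimately show ?case by (simp add: w)
qed simp

text \<open>
  At an odd position the letters \<open>1\<close> at the even positions of \<open>pd p\<close> meet the images under
  \<open>flip\<close>, and conversely, so that all letters of \<open>p\<close> and the letters below it are \<open>0\<close>.
\<close>

lemma pd_shifted_prefix:
  "set p \<subseteq> {0, 1} \<Longrightarrow> set (a # w) \<subseteq> {0, 1} \<Longrightarrow> prefix (pd p) (flip a # pd w @ [1]) \<Longrightarrow> prefix p (a # w)"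
proof (induction p arbitrary: a w)
  case (Cons b p)
  have a: "a = 0" using Cons.prems by auto
  have b: "b = 0" using Cons.prems by (cases w) auto
  show ?case
  proof (cases w)
    case Nil
    then show ?thesis using Cons.prems(3) a b by (cases p) simp_all
  next
    case (Cons c v)
    have "prefix (pd p) (flip c # pd v @ [1])" using Cons.prems(3) unfolding Cons by simp
    then have "prefix p (c # v)" using Cons.prems(1,2) Cons by (intro Cons.IH) simp_all
    then show ?thesis using a b Cons by simp
  qed
qed simp

text \<open>An occurrence begins either at a block boundary, where \<open>pd_prefix\<close> applies,
  or at the second letter of a block, where \<open>pd_shifted_prefix\<close> does.\<close>

lemma pd_sublist:
  "set p \<subseteq> {0, 1} \<Longrightarrow> set w \<subseteq> {0, 1} \<Longrightarrow> sublist (pd p) (pd w @ [1]) \<Longrightarrow> sublist p w"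
proof (induction w)
  case Nil
  then show ?case by (cases p) (simp_all add: sublist_Cons_right)
next
  case (Cons a w)
  consider "prefix (pd p) (pd (a # w) @ [1])" | "prefix (pd p) (flip a # pd w @ [1])"
    | "sublist (pd p) (pd w @ [1])"
    using Cons.prems(3) by (auto simp: sublist_Cons_right)
  then show ?case
  proof cases
    case 1
    then show ?thesis using pd_prefix[of p "a # w"] Cons.prems by (simp only: sublist_Cons_right) blast
  next
    case 2
    then show ?thesis using pd_shifted_prefix[of p a w] Cons.prems by (simp only: sublist_Cons_right) blast
  next
    case 3
    then show ?thesis using Cons.IH Cons.prems(1,2) by (simp add: sublist_Cons_right)
  qed
qed

text \<open>The word is out of phase with the blocks: each flipped letter meets the \<open>1\<close>
  opening a block or the final \<open>1\<close>.\<close>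

lemma pd_tl_prefix:
  "set (a # p) \<subseteq> {0, 1} \<Longrightarrow> prefix (flip a # pd p) (pd w @ [1]) \<Longrightarrow> set (a # p) \<subseteq> {0}"
proof (induction p arbitrary: a w)
  case Nil
  then show ?case by (cases w) auto
next
  case (Cons b p)
  have a: "a = 0" using Cons.prems by (cases w) auto
  obtain c v where w: "w = c # v" using Cons.prems(2) by (cases w) simp_all
  have "prefix (flip b # pd p) (pd v @ [1])" using Cons.prems(2) w by simp
  then have "set (b # p) \<subseteq> {0}" using Cons.prems(1) by (intro Cons.IH) simp_all
  then show ?case using a by simp
qed

lemma pd_tl_sublist:
  assumes "set p \<subseteq> {0, 1}" "1 \<in> set p"
  shows "set w \<subseteq> {0, 1} \<Longrightarrow> sublist (tl (pd p)) (pd w @ [1]) \<Longrightarrow> sublist p w"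
proof (induction w)
  case Nil
  obtain b p' where p: "p = b # p'" using assms(2) by (cases p) auto
  have "prefix (flip b # pd p') (pd [] @ [1])" using Nil p by (simp add: sublist_Cons_right)
  from pd_tl_prefix[OF _ this] show ?case using assms p by auto
next
  case (Cons a w)
  obtain b p' where p: "p = b # p'" using assms(2) by (cases p) auto
  consider "prefix (tl (pd p)) (pd (a # w) @ [1])" | "prefix (tl (pd p)) (flip a # pd w @ [1])"
    | "sublist (tl (pd p)) (pd w @ [1])"
    using Cons.prems(2) by (auto simp: sublist_Cons_right)
  then show ?case
  proof cases
    case 1
    then have "set (b # p') \<subseteq> {0}"
      using assms(1) unfolding p by (intro pd_tl_prefix[of b p' "a # w"]) simp_all
    then show ?thesis using assms(2) p by auto
  next
    case 2
    \<comment> \<open>The \<open>1\<close> opening the block extends the occurrence of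
      \<open>tl (pd p)\<close> to one of \<open>pd p\<close>.\<close>
    then have "prefix (pd p) (pd (a # w) @ [1])" by (simp add: p)
    then show ?thesis using pd_prefix[of p "a # w"] assms Cons.prems by (simp only: sublist_Cons_right) blast
  next
    case 3
    then show ?thesis using Cons.IH Cons.prems(1) by (simp add: sublist_Cons_right)
  qed
qed

lemma pd_zeros: "set p \<subseteq> {0} \<Longrightarrow> pd p = replicate (2 * length p) 1"
  by (induction p) (simp_all add: flip_def)

lemma period_doubling_class_P: "\<exists>q. period_doubling_morphism b = 1 # q \<and> rev q = q"
  by (simp add: period_doubling_morphism_def)

lemma rich_period_doubling_morphism:
  assumes "rich w" "set w \<subseteq> {0, 1}"
  shows "rich (pd w @ [1])"
proof (rule rich_morph[OF _ _ assms])
  show "\<exists>q. period_doubling_morphism b = 1 # q" for b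
    using period_doubling_class_P by blast
  fix w p :: "nat list" and a
  assume letters: "set (w @ [a]) \<subseteq> {0, 1}" and p: "suffix p (w @ [a])" "palindrome p" "\<not> sublist p w"
  have ne: "p \<noteq> []" using p(3) by auto
  have set_p: "set p \<subseteq> {0, 1}" using letters p(1) set_mono_suffix by blast
  \<comment> \<open>If \<open>p\<close> consists of \<open>n\<close> zeros, \<open>w\<close> ends in
    \<open>n - 1\<close> zeros, so \<open>tl (pd p)\<close>, which is a run of
    \<open>2 * n - 1\<close> ones, already occurs in \<open>pd w @ [1]\<close>.\<close>
  define q where "q = (if 1 \<in> set p then tl (pd p) else pd p)"
  have "set p \<subseteq> {0}" if "1 \<notin> set p"
    using set_p that by blast
  then have "palindrome (pd p)" if "1 \<notin> set p"
    using that pd_zeros[of p] by (simp add: palindrome_def)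
  then have pal: "palindrome (pd p @ [1])" "palindrome q"
    using palindrome_morph[where \<phi> = period_doubling_morphism, OF period_doubling_class_P p(2)]
    by (simp_all add: q_def)
  have q: "sublist q (pd p @ [1])" "length q < length (pd p @ [1])"
    using sublist_order.order_trans[OF sublist_tl] by (auto simp: q_def)
  have "sublist (pd p @ [1]) (pd (w @ [a]) @ [1])"
    using suffix_morph[OF p(1)] by blast
  moreover from q(1) this have "sublist q (pd (w @ [a]) @ [1])"
    by (rule sublist_order.order_trans)
  moreover have "\<not> sublist q (pd w @ [1])"
    using pd_sublist[of p w] pd_tl_sublist[of p w] set_p letters p(3) by (auto simp: q_def)
  \<comment> \<open>The longer palindrome contains \<open>q\<close> and inherits its
    newness.\<close>
  moreover from this q(1) have "\<not> sublist (pd p @ [1]) (pd w @ [1])"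
    using sublist_order.order_trans by blast
  ultimately have "{pd p @ [1], q} \<subseteq> pal_factors (pd (w @ [a]) @ [1]) - pal_factors (pd w @ [1])"
    using pal by (simp add: pal_factors_def)
  moreover have "card {pd p @ [1], q} = length (period_doubling_morphism a)"
  proof -
    have "q \<noteq> pd p @ [1]" using q(2) by blast
    then show ?thesis by (simp add: period_doubling_morphism_def)
  qed
  ultimately show "\<exists>P \<subseteq> pal_factors (pd (w @ [a]) @ [1]) - pal_factors (pd w @ [1]).
      card P = length (period_doubling_morphism a)" by blast
qed

lemma rich_period_doubling:
  assumes "is_factor w period_doubling"
  shows "rich w"
proof (rule rich_fixed_point[OF period_doubling_fixed_point(2) _ _ assms])
  show "\<exists>q. period_doubling_morphism b = 1 # q" for b
    using period_doubling_class_P by blast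
  have "period_doubling n \<in> {0, 1}" for n
    using fixed_point_letter[OF period_doubling_fixed_point(2), of n]
    by (auto simp: period_doubling_morphism_def split: if_splits)
  then have "range period_doubling \<subseteq> {0, 1}" by (simp add: image_subset_iff)
  then show "rich (pd w @ [1])" if "set w \<subseteq> range period_doubling" "rich w" for w
    using that by (intro rich_period_doubling_morphism) auto
qed

section \<open>The Fibonacci sequence\<close>

abbreviation "fib \<equiv> morph fibonacci_morphism"

lemma fib_simps [simp]: "fib [] = []" "fib (a # w) = 0 # (if a = 0 then 1 # fib w else fib w)"
  by (simp_all add: morph_def fibonacci_morphism_def)

lemma fib_not_1: "\<not> prefix (1 # u) (fib w @ [0])" "\<not> prefix (fib w @ 0 # u) (1 # v)"
  by (cases w; simp)+

text \<open>Every block opens with \<open>0\<close>, so the letter after that \<open>0\<close> tells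
  \<open>01\<close> from \<open>0\<close>. The closing \<open>0\<close> supplies this letter for the
  last block of \<open>p\<close>.\<close>

lemma fib_prefix:
  "set p \<subseteq> {0, 1} \<Longrightarrow> set w \<subseteq> {0, 1} \<Longrightarrow> prefix (fib p @ [0]) (fib w @ [0]) \<Longrightarrow> prefix p w"
proof (induction p arbitrary: w)
  case (Cons a p)
  obtain b v where w: "w = b # v" using Cons.prems(3) by (cases w) (simp_all split: if_splits)
  have "a = b" "prefix (fib p @ [0]) (fib v @ [0])"
    using Cons.prems fib_not_1 by (auto simp: w split: if_splits)
  moreover from this have "prefix p v" using Cons.prems(1,2) w by (intro Cons.IH) simp_all
  ultimately show ?case by (simp add: w)
qed simp

text \<open>Here the last block of \<open>p\<close> is \<open>01\<close>, which its own
  \<open>1\<close> identifies.\<close>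

lemma fib_prefix_last_0:
  "p \<noteq> [] \<Longrightarrow> last p = 0 \<Longrightarrow> set p \<subseteq> {0, 1} \<Longrightarrow> set w \<subseteq> {0, 1} \<Longrightarrow>
    prefix (fib p) (fib w @ [0]) \<Longrightarrow> prefix p w"
proof (induction p arbitrary: w)
  case (Cons a p)
  obtain b v where w: "w = b # v"
    using Cons.prems(2,5) by (cases w; cases p) (simp_all split: if_splits)
  show ?case
  proof (cases p)
    case Nil
    then show ?thesis using Cons.prems fib_not_1 by (auto simp: w split: if_splits)
  next
    case (Cons c p')
    obtain t where t: "fib p = 0 # t" using Cons by simp
    have "a = b" "prefix (fib p) (fib v @ [0])"
      using Cons.prems(3-5) fib_not_1(1) t by (auto simp: w split: if_splits)
    moreover from this have "prefix p v"
      using Cons.prems Cons w by (intro Cons.IH) simp_all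
    ultimately show ?thesis by (simp add: w)
  qed
qed simp

text \<open>A \<open>0\<close> occurs only at the start of a block or as the closing letter, so the
  occurrence is aligned with the blocks of a suffix.\<close>

lemma fib_sublist_sync:
  "sublist (0 # u) (fib w @ [0]) \<Longrightarrow> \<exists>s. suffix s w \<and> prefix (0 # u) (fib s @ [0])"
proof (induction w)
  case Nil
  then show ?case by (auto simp: sublist_Cons_right)
next
  case (Cons a w)
  then have "prefix (0 # u) (fib (a # w) @ [0]) \<or> sublist (0 # u) (fib w @ [0])"
    by (auto simp: sublist_Cons_right split: if_splits)
  then show ?case using Cons.IH by (metis suffix_ConsI suffix_order.order_refl)
qed

text \<open>A \<open>1\<close> occurs only as the second letter of a block
  \<open>01\<close>.\<close>

lemma fib_sublist_1: "sublist (1 # u) (fib w @ [0]) \<Longrightarrow> sublist (0 # 1 # u) (fib w @ [0])"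
proof (induction w)
  case Nil
  then show ?case by (auto simp: sublist_Cons_right)
next
  case (Cons a w)
  then show ?case by (auto simp: sublist_Cons_right split: if_splits)
qed

lemma fibonacci_class_P: "\<exists>q. fibonacci_morphism b = 0 # q \<and> rev q = q"
  by (simp add: fibonacci_morphism_def)

lemma rich_fibonacci_morphism:
  assumes "rich w" "set w \<subseteq> {0, 1}"
  shows "rich (fib w @ [0])"
proof (rule rich_morph[OF _ _ assms])
  show "\<exists>q. fibonacci_morphism b = 0 # q" for b
    using fibonacci_class_P by blast
  fix w p :: "nat list" and a
  assume letters: "set (w @ [a]) \<subseteq> {0, 1}" and p: "suffix p (w @ [a])" "palindrome p" "\<not> sublist p w"
  let ?new = "pal_factors (fib (w @ [a]) @ [0]) - pal_factors (fib w @ [0])"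
  have ne: "p \<noteq> []" using p(3) by auto
  have set_p: "set p \<subseteq> {0, 1}" using letters p(1) set_mono_suffix by blast
  have last: "last p = a" using p(1) ne by (metis last_appendR last_snoc suffix_def Sublist.suffix_def)
  have sync: "\<not> prefix p s" if "suffix s w" for s
    using that p(3) by (auto simp: Sublist.suffix_def Sublist.prefix_def sublist_def)
  have set_s: "set s \<subseteq> {0, 1}" if "suffix s w" for s
    using that letters set_mono_suffix by fastforce
  note pal = palindrome_morph[where \<phi> = fibonacci_morphism, OF fibonacci_class_P p(2)]
  have sub: "sublist (fib p @ [0]) (fib (w @ [a]) @ [0])"
    using suffix_morph[OF p(1)] by blast
  obtain t where t: "fib p = 0 # t" using ne by (cases p) auto
  have "\<not> sublist (fib p @ [0]) (fib w @ [0])"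
    using fib_sublist_sync[of "t @ [0]" w] fib_prefix[OF set_p] sync set_s t by auto
  then have new: "fib p @ [0] \<in> ?new"
    using sub pal(1) by (simp add: pal_factors_def)
  show "\<exists>P \<subseteq> ?new. card P = length (fibonacci_morphism a)"
  proof (cases "a = 0")
    case True
    \<comment> \<open>The palindrome \<open>p\<close> ends and hence begins with \<open>0\<close>,
      so \<open>t\<close> begins with \<open>1\<close>; any occurrence of \<open>t\<close> extends
      to the left to one of \<open>fib p\<close>.\<close>
    have "hd p = 0" using True last p(2) ne by (metis hd_rev palindrome_def)
    then obtain t' where t': "t = 1 # t'" using ne t by (cases p) auto
    have "\<not> sublist t (fib w @ [0])"
    proof
      assume "sublist t (fib w @ [0])"
      then have "sublist (0 # t) (fib w @ [0])" unfolding t' by (rule fib_sublist_1)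
      from fib_sublist_sync[OF this] obtain s where s: "suffix s w" "prefix (fib p) (fib s @ [0])"
        unfolding t by blast
      have "prefix p s"
        using fib_prefix_last_0[OF ne _ set_p set_s[OF s(1)] s(2)] last True by simp
      then show False using sync[OF s(1)] by simp
    qed
    moreover have "sublist t (fib p @ [0])" unfolding t by (auto simp: sublist_Cons_right)
    ultimately have "t \<in> ?new"
      using sublist_order.order_trans[OF _ sub] pal(2) t by (simp add: pal_factors_def)
    moreover have "card {fib p @ [0], t} = 2" by (simp add: t)
    ultimately show ?thesis
      using new True by (intro exI[of _ "{fib p @ [0], t}"]) (simp add: fibonacci_morphism_def)
  next
    case False
    then show ?thesis
      using new by (intro exI[of _ "{fib p @ [0]}"]) (simp add: fibonacci_morphism_def)
  qed
qed

lemma rich_fibonacci: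
  assumes "is_factor w fibonacci"
  shows "rich w"
proof (rule rich_fixed_point[OF fibonacci_fixed_point(2) _ _ assms])
  show "\<exists>q. fibonacci_morphism b = 0 # q" for b
    using fibonacci_class_P by blast
  have "fibonacci n \<in> {0, 1}" for n
    using fixed_point_letter[OF fibonacci_fixed_point(2), of n]
    by (auto simp: fibonacci_morphism_def split: if_splits)
  then have "range fibonacci \<subseteq> {0, 1}" by (simp add: image_subset_iff)
  then show "rich (fib w @ [0])" if "set w \<subseteq> range fibonacci" "rich w" for w
    using that by (intro rich_fibonacci_morphism) auto
qed

theorem theorem6:
  shows "(card (rich_factors thue_morse) = 161 \<and> Max (length ` rich_factors thue_morse) = 16)
    \<and> (card (rich_factors rudin_shapiro) = 975 \<and> Max (length ` rich_factors rudin_shapiro) = 30)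
    \<and> (card (rich_factors paperfolding) = 494 \<and> Max (length ` rich_factors paperfolding) = 23)
    \<and> ((\<forall>n. \<exists>w \<in> rich_factors period_doubling. length w = n)
        \<and> (\<forall>w. is_factor w period_doubling \<longrightarrow> rich w))
    \<and> (\<forall>w. is_factor w fibonacci \<longrightarrow> rich w)"
proof -
  have "\<exists>w \<in> rich_factors period_doubling. length w = n" for n
    using is_factor_subsequence[of period_doubling 0 n]
    by (intro bexI[of _ "period_doubling [0 \<rightarrow> n]"]) (simp_all add: rich_factors_def rich_period_doubling)
  then show ?thesis
    using rich_factors_thue_morse rich_factors_rudin_shapiro rich_factors_paperfolding
      rich_period_doubling rich_fibonacci by blast
qed

end
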